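(* Borel graphability is closed under countable infinite products: if for each $i\in\mathbb{N}$, $E_i$ is a Borel graphable equivalence relation on a Polish space $X_i$, then the product equivalence relation $E=\prod_iE_i$ on $\prod_iX_i$, defined by $x\,E\,y\iff \forall i\ (x_i\,E_i\,y_i)$, is Borel graphable.
   Context: An equivalence relation $E$ on a Polish space $X$ is Borel graphable if there is a Borel graph on $X$ whose connectedness relation ($x,y$ related iff joined by a finite path) equals $E$. *)

theory Defs
  imports "HOL-Analysis.Analysis"
begin

definition polish_topology :: "'a topology \<Rightarrow> bool" where
  "polish_topology X \<longleftrightarrow> separable_space X \<and> completely_metrizable_space X"

definition borel_sets_of :: "'a topology \<Rightarrow> 'a set set" where
  "borel_sets_of X = sigma_sets (topspace X) {U. openin X U}"

definition borel_graph :: "'a topology \<Rightarrow> ('a \<times> 'a) set \<Rightarrow> bool" where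
  "borel_graph X G \<longleftrightarrow> G \<in> borel_sets_of (prod_topology X X) \<and> sym G \<and> irrefl G"

text \<open>Paths of length 0 are allowed, so every point of the space is connected to itself.\<close>

definition connectedness_relation :: "'a topology \<Rightarrow> ('a \<times> 'a) set \<Rightarrow> ('a \<times> 'a) set" where
  "connectedness_relation X G = {(x, y). x \<in> topspace X \<and> y \<in> topspace X \<and> (x, y) \<in> G\<^sup>*}"

definition borel_graphable :: "'a topology \<Rightarrow> ('a \<times> 'a) set \<Rightarrow> bool" where
  "borel_graphable X E \<longleftrightarrow>
     polish_topology X \<and> equiv (topspace X) E \<and>
     (\<exists>G. borel_graph X G \<and> connectedness_relation X G = E)"

definition product_relation ::
    "(nat \<Rightarrow> 'a topology) \<Rightarrow> (nat \<Rightarrow> ('a \<times> 'a) set) \<Rightarrow> ((nat \<Rightarrow> 'a) \<times> (nat \<Rightarrow> 'a)) set" where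
  "product_relation X E =
     {(x, y). x \<in> topspace (product_topology X UNIV) \<and> y \<in> topspace (product_topology X UNIV) \<and>
              (\<forall>i. (x i, y i) \<in> E i)}"

end

theory Submission
  imports Defs
begin

text \<open>
  Let \<open>G\<^sub>j\<close> be a Borel graph for \<open>E\<^sub>j\<close>. Moving every coordinate along at most one edge of \<open>G\<^sub>j\<close>
  is a Borel graph, but it connects \<open>x\<close> with \<open>y\<close> only if the distances in the coordinates are
  bounded, and "there is a path from \<open>u\<^sub>j\<close> to \<open>v\<^sub>j\<close> in \<open>G\<^sub>j\<close>" is only an analytic condition.
  The remedy is to let the pair \<open>(u, v)\<close> itself carry the paths. List the coordinates at which \<open>u\<close>
  and \<open>v\<close> differ in increasing order and split them by the parity of their position. At the
  coordinates of one parity, \<open>u\<^sub>j\<close> and \<open>v\<^sub>j\<close> are required to be adjacent, and a Borel linear order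
  on \<open>X\<^sub>j\<close> reads one bit off each of these pairs. The resulting bit sequence is decoded into
  candidate paths for all other coordinates, and checking that they really lead from \<open>u\<^sub>j\<close> to
  \<open>v\<^sub>j\<close> is Borel.

  If \<open>x\<close> and \<open>y\<close> differ at infinitely many coordinates, then each of these has a neighbour, hence room
  for one bit, and two such moves, one for each parity, lead from \<open>x\<close> to \<open>y\<close>. If they
  differ at finitely many coordinates, single steps suffice.
\<close>

section \<open>Borel sets of Polish spaces\<close>

text \<open>Packages \<open>borel_sets_of X\<close> as a measure space, so that measurable functions
  and predicates can be used.\<close>

definition borel_space_of :: "'a topology \<Rightarrow> 'a measure" where
  "borel_space_of X = sigma (topspace X) {U. openin X U}"

lemma space_borel_space_of [simp]: "space (borel_space_of X) = topspace X"
  by (auto simp: borel_space_of_def space_measure_of_conv)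

lemma sets_borel_space_of: "sets (borel_space_of X) = borel_sets_of X"
  unfolding borel_space_of_def borel_sets_of_def
  by (rule sets_measure_of) (auto dest: openin_subset)

lemma openin_in_borel: "openin X U \<Longrightarrow> U \<in> sets (borel_space_of X)"
  by (simp add: sets_borel_space_of borel_sets_of_def sigma_sets.Basic)

lemma closedin_in_borel:
  assumes "closedin X C"
  shows "C \<in> sets (borel_space_of X)"
proof -
  have "topspace X - (topspace X - C) \<in> sets (borel_space_of X)"
    using assms sets.compl_sets[OF openin_in_borel[of X "topspace X - C"]]
    by (auto simp: closedin_def)
  then show ?thesis
    using closedin_subset[OF assms] by (simp add: double_diff)
qed

lemma measurable_borel_space_ofI:
  assumes "f \<in> space N \<rightarrow> topspace Y"
    and "\<And>U. openin Y U \<Longrightarrow> f -` U \<inter> space N \<in> sets N"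
  shows "f \<in> measurable N (borel_space_of Y)"
  unfolding borel_space_of_def
  by (rule measurable_measure_of) (use assms in \<open>auto dest: openin_subset\<close>)

lemma continuous_map_measurable_borel:
  assumes "continuous_map X Y f"
  shows "f \<in> measurable (borel_space_of X) (borel_space_of Y)"
proof (rule measurable_borel_space_ofI)
  fix U assume "openin Y U"
  then have "openin X {x \<in> topspace X. f x \<in> U}"
    using assms by (auto simp: continuous_map_def)
  moreover have "f -` U \<inter> space (borel_space_of X) = {x \<in> topspace X. f x \<in> U}"
    by auto
  ultimately show "f -` U \<inter> space (borel_space_of X) \<in> sets (borel_space_of X)"
    by (simp add: openin_in_borel)
qed (use assms in \<open>auto simp: continuous_map_def\<close>)

section \<open>Dense sequences, countable bases and countable products\<close>

definition countable_base :: "'a topology \<Rightarrow> (nat \<Rightarrow> 'a set) \<Rightarrow> bool" where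
  "countable_base X U \<longleftrightarrow>
     (\<forall>n. openin X (U n)) \<and> (\<forall>V x. openin X V \<and> x \<in> V \<longrightarrow> (\<exists>n. x \<in> U n \<and> U n \<subseteq> V))"

definition dense_sequence :: "'a topology \<Rightarrow> (nat \<Rightarrow> 'a) \<Rightarrow> bool" where
  "dense_sequence X q \<longleftrightarrow>
     range q \<subseteq> topspace X \<and> (\<forall>V. openin X V \<and> V \<noteq> {} \<longrightarrow> (\<exists>n. q n \<in> V))"

lemma dense_sequenceD:
  assumes "dense_sequence X q" "openin X V" "x \<in> V"
  shows "\<exists>n. q n \<in> V"
  using assms unfolding dense_sequence_def by blast

lemma separable_space_imp_dense_sequence:
  assumes "separable_space X" "topspace X \<noteq> {}"
  shows "\<exists>q. dense_sequence X q"
proof -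
  obtain C where C: "countable C" "C \<subseteq> topspace X" "X closure_of C = topspace X"
    using assms(1) by (auto simp: separable_space_def)
  then have "C \<noteq> {}"
    using assms(2) by (metis closure_of_empty)
  then have rng: "range (from_nat_into C) = C"
    using C(1) by (rule range_from_nat_into)
  have "\<exists>n. from_nat_into C n \<in> V" if V: "openin X V" "V \<noteq> {}" for V
  proof -
    have "V \<inter> C \<noteq> {}"
      using V C(3) openin_Int_closure_of_eq_empty[of X V C] openin_subset[of X V] by auto
    then show ?thesis
      using rng by (metis disjoint_iff imageE)
  qed
  then show ?thesis
    using rng C(2) unfolding dense_sequence_def by blast
qed

lemma dense_sequence_imp_separable_space:
  assumes "dense_sequence X q"
  shows "separable_space X"
  unfolding separable_space_def
proof (intro exI[of _ "range q"] conjI)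
  show "X closure_of range q = topspace X"
    using assms unfolding dense_sequence_def in_closure_of set_eq_iff by blast
qed (use assms in \<open>auto simp: dense_sequence_def\<close>)

lemma polish_topology_countable_base:
  assumes "polish_topology X"
  shows "\<exists>U. countable_base X U"
proof (cases "topspace X = {}")
  case True
  then have "countable_base X (\<lambda>_. {})"
    using openin_subset by (fastforce simp: countable_base_def)
  then show ?thesis by blast
next
  case False
  obtain M d where Md: "Metric_space M d" "X = Metric_space.mtopology M d"
    using assms by (auto simp: polish_topology_def completely_metrizable_space_def)
  interpret Metric_space M d by fact
  obtain q where q: "dense_sequence X q"
    using separable_space_imp_dense_sequence assms False by (auto simp: polish_topology_def)
  define B where "B = (\<lambda>n. case prod_decode n of (i, k) \<Rightarrow> mball (q i) (inverse (real (Suc k))))"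
  have "\<exists>n. x \<in> B n \<and> B n \<subseteq> V" if V: "openin X V" "x \<in> V" for V x
  proof -
    have x: "x \<in> M"
      using V openin_subset Md(2) by fastforce
    obtain r where r: "r > 0" "mball x r \<subseteq> V"
      using V Md(2) openin_mtopology by blast
    \<comment> \<open>Half of \<open>r\<close>, because a ball that contains \<open>x\<close> is
      contained in the ball about \<open>x\<close> of twice its radius.\<close>
    obtain k where k: "inverse (real (Suc k)) < r / 2"
      using reals_Archimedean[of "r / 2"] r by auto
    have "openin X (mball x (inverse (real (Suc k))))" "x \<in> mball x (inverse (real (Suc k)))"
      using Md(2) x by auto
    then obtain i where i: "q i \<in> mball x (inverse (real (Suc k)))"
      using dense_sequenceD[OF q] by blast
    have "x \<in> mball (q i) (inverse (real (Suc k)))"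
      using i commute by auto
    moreover have "mball (q i) (inverse (real (Suc k))) \<subseteq> mball x r"
    proof
      fix y assume "y \<in> mball (q i) (inverse (real (Suc k)))"
      then show "y \<in> mball x r"
        using i k triangle[of x "q i" y] x by auto
    qed
    ultimately have "x \<in> B (prod_encode (i, k)) \<and> B (prod_encode (i, k)) \<subseteq> V"
      using r by (auto simp: B_def)
    then show ?thesis by blast
  qed
  moreover have "openin X (B n)" for n
    by (auto simp: B_def Md(2) split: prod.split)
  ultimately show ?thesis
    unfolding countable_base_def by blast
qed

lemma polish_topology_product_topology:
  fixes X :: "nat \<Rightarrow> 'a topology"
  assumes X: "\<And>i. polish_topology (X i)"
  shows "polish_topology (product_topology X UNIV)"
proof -
  have "separable_space (product_topology X UNIV)"
  proof (cases "topspace (product_topology X UNIV) = {}")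
    case True
    then show ?thesis
      by (auto simp: separable_space_def)
  next
    case False
    then have "topspace (X i) \<noteq> {}" for i
      by (auto simp: PiE_eq_empty_iff)
    then have "\<exists>q. dense_sequence (X i) q" for i
      using X separable_space_imp_dense_sequence by (auto simp: polish_topology_def)
    then obtain q where q: "\<And>i. dense_sequence (X i) (q i)"
      by metis
    \<comment> \<open>\<open>n\<close> codes a finite list of indices, continued by 0. Countably
      many such points are dense, since a basic open set restricts only finitely many
      coordinates.\<close>
    define p where
      "p = (\<lambda>n i. let l = from_nat n :: nat list in q i (if i < length l then l ! i else 0))"
    have "dense_sequence (product_topology X UNIV) p"
      unfolding dense_sequence_def
    proof (intro conjI allI impI)
      show "range p \<subseteq> topspace (product_topology X UNIV)"
        using q by (auto simp: p_def dense_sequence_def Let_def)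
      fix V assume "openin (product_topology X UNIV) V \<and> V \<noteq> {}"
      then obtain x where x: "x \<in> V" and V: "openin (product_topology X UNIV) V" by auto
      then obtain U where U: "finite {i. U i \<noteq> topspace (X i)}" "\<And>i. openin (X i) (U i)"
          "x \<in> Pi\<^sub>E UNIV U" "Pi\<^sub>E UNIV U \<subseteq> V"
        unfolding openin_product_topology_alt by auto
      obtain N where N: "\<And>i. U i \<noteq> topspace (X i) \<Longrightarrow> i < N"
        using U(1) finite_nat_set_iff_bounded by auto
      have "\<exists>n. q i n \<in> U i" for i
        using dense_sequenceD[OF q U(2)] U(3) by (auto simp: PiE_iff)
      then obtain f where f: "\<And>i. q i (f i) \<in> U i"
        by metis
      have "p (to_nat (map f [0..<N])) i \<in> U i" for i
        using f[of i] N[of i] q[of i] by (cases "i < N") (auto simp: p_def dense_sequence_def)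
      then show "\<exists>n. p n \<in> V"
        using U(4) by (auto simp: PiE_iff subset_iff)
    qed
    then show ?thesis
      by (rule dense_sequence_imp_separable_space)
  qed
  moreover have "completely_metrizable_space (product_topology X UNIV)"
    using X by (simp add: completely_metrizable_space_product_topology polish_topology_def)
  ultimately show ?thesis
    by (simp add: polish_topology_def)
qed

section \<open>Borel subsets of the square of a space\<close>

lemma borel_prod_topology_subset:
  assumes "countable_base X U"
  shows "sets (borel_space_of (prod_topology X X)) \<subseteq> sets (borel_space_of X \<Otimes>\<^sub>M borel_space_of X)"
proof -
  have rect: "W \<in> sets (borel_space_of X \<Otimes>\<^sub>M borel_space_of X)" if W: "openin (prod_topology X X) W" for W
  proof -
    \<comment> \<open>The countable base makes this union of rectangles countable, hence measurable
      in the product sigma-algebra.\<close>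
    have "W = (\<Union>(m, n) \<in> {(m, n). U m \<times> U n \<subseteq> W}. U m \<times> U n)"
    proof (intro subset_antisym subsetI)
      fix w assume w: "w \<in> W"
      then obtain A B where AB: "openin X A" "openin X B" "fst w \<in> A" "snd w \<in> B" "A \<times> B \<subseteq> W"
        using W unfolding openin_prod_topology_alt by (metis prod.collapse)
      then obtain m n where "fst w \<in> U m" "U m \<subseteq> A" "snd w \<in> U n" "U n \<subseteq> B"
        using assms unfolding countable_base_def by metis
      with AB have "w \<in> U m \<times> U n" "U m \<times> U n \<subseteq> W"
        by (auto simp: mem_Times_iff)
      then show "w \<in> (\<Union>(m, n) \<in> {(m, n). U m \<times> U n \<subseteq> W}. U m \<times> U n)"
        by blast
    qed blast
    also have "\<dots> \<in> sets (borel_space_of X \<Otimes>\<^sub>M borel_space_of X)"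
    proof (rule sets.countable_UN'')
      fix p assume "p \<in> {(m, n). U m \<times> U n \<subseteq> W}"
      show "(case p of (m, n) \<Rightarrow> U m \<times> U n) \<in> sets (borel_space_of X \<Otimes>\<^sub>M borel_space_of X)"
        using assms by (auto simp: countable_base_def intro!: openin_in_borel split: prod.split)
    qed simp
    finally show ?thesis .
  qed
  then show ?thesis
    unfolding sets_borel_space_of[of "prod_topology X X"] borel_sets_of_def
    by (intro sets.sigma_sets_subset' subsetI rect)
       (use openin_topspace[of "prod_topology X X"] in auto)
qed

lemma diagonal_in_borel:
  assumes "polish_topology X" "countable_base X U"
  shows "{(x, x) | x. x \<in> topspace X} \<in> sets (borel_space_of X \<Otimes>\<^sub>M borel_space_of X)"
proof -
  have "Hausdorff_space X"
    using assms(1) completely_metrizable_imp_metrizable_space metrizable_imp_Hausdorff_space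
    by (auto simp: polish_topology_def)
  then have "closedin (prod_topology X X) {(x, x) | x. x \<in> topspace X}"
    by (simp add: Hausdorff_space_closedin_diagonal image_def Setcompr_eq_image)
  then show ?thesis
    using closedin_in_borel borel_prod_topology_subset[OF assms(2)] by blast
qed

section \<open>Borel parametrization by Baire space\<close>

abbreviation baire_space :: "(nat \<Rightarrow> nat) measure" where
  "baire_space \<equiv> Pi\<^sub>M UNIV (\<lambda>_. count_space UNIV)"

text \<open>A sequence \<open>c\<close> names the limit of \<open>q (c i)\<close>, for a dense
  sequence \<open>q\<close>, whenever these points converge fast; all other sequences name
  \<open>q 0\<close>. This is how vertices of paths will be stored as natural numbers.\<close>

lemma polish_topology_borel_surjection:
  assumes "polish_topology X" "topspace X \<noteq> {}"
  shows "\<exists>h \<in> measurable baire_space (borel_space_of X). \<forall>x \<in> topspace X. \<exists>c. h c = x"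
proof -
  obtain M d where Md: "Metric_space M d" "Metric_space.mcomplete M d"
      and X: "X = Metric_space.mtopology M d"
    using assms by (auto simp: polish_topology_def completely_metrizable_space_def)
  interpret Metric_space M d by fact
  obtain q where q: "dense_sequence X q"
    using separable_space_imp_dense_sequence assms by (auto simp: polish_topology_def)
  have qM [simp]: "q n \<in> M" for n
    using q X by (auto simp: dense_sequence_def)
  define fast where "fast c \<longleftrightarrow> (\<forall>i. d (q (c i)) (q (c (Suc i))) < (1/2) ^ i)" for c
  \<comment> \<open>The bound is the exact geometric sum of the steps from \<open>i\<close> to
    \<open>i + n\<close>, which lets the induction close.\<close>
  have dist: "d (q (c i)) (q (c (i + n))) \<le> 2 * (1/2) ^ i - 2 * (1/2) ^ (i + n)" if "fast c" for c i n
  proof (induction n)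
    case (Suc n)
    have "d (q (c (i + n))) (q (c (Suc (i + n)))) < (1/2) ^ (i + n)"
      using that by (auto simp: fast_def)
    then show ?case
      using Suc triangle[of "q (c i)" "q (c (i + n))" "q (c (Suc (i + n)))"] by simp
  qed simp
  have dist_le: "d (q (c i)) (q (c (i + n))) \<le> 2 * (1/2) ^ i" if "fast c" for c i n
    by (rule order_trans[OF dist[OF that]]) simp
  have small: "\<exists>i. 2 * (1/2 :: real) ^ i < e" if "e > 0" for e
    using real_arch_pow_inv[of "e / 2" "1/2"] that by (auto simp: mult.commute)
  have lim: "\<exists>x. limitin X (\<lambda>i. q (c i)) x sequentially" if c: "fast c" for c
  proof -
    have "MCauchy (\<lambda>i. q (c i))"
      unfolding MCauchy_def
    proof (intro conjI allI impI)
      fix e :: real assume "e > 0"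
      then obtain i where i: "2 * (1/2 :: real) ^ i < e / 2"
        using small[of "e / 2"] by auto
      have "d (q (c n)) (q (c m)) < e" if "i \<le> n" "i \<le> m" for n m
        using that dist_le[OF c, of i "n - i"] dist_le[OF c, of i "m - i"] i
          triangle''[of "q (c n)" "q (c i)" "q (c m)"] by auto
      then show "\<exists>N. \<forall>n n'. N \<le> n \<longrightarrow> N \<le> n' \<longrightarrow> d (q (c n)) (q (c n')) < e" by blast
    qed auto
    then show ?thesis
      using Md(2) X by (auto simp: mcomplete_def)
  qed
  define h where
    "h c = (if fast c then SOME x. limitin X (\<lambda>i. q (c i)) x sequentially else q 0)" for c
  have h_lim: "limitin X (\<lambda>i. q (c i)) (h c) sequentially" if "fast c" for c
    using someI_ex[OF lim[OF that]] that by (simp add: h_def)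
  have hM: "h c \<in> M" for c
    using h_lim[of c] X by (cases "fast c") (auto simp: h_def limit_metric_sequentially)
  have h_dist: "d (q (c i)) (h c) \<le> 2 * (1/2) ^ i" if c: "fast c" for c i
  proof (rule field_le_epsilon)
    fix e :: real assume "e > 0"
    then have "\<exists>N. \<forall>n\<ge>N. q (c n) \<in> M \<and> d (q (c n)) (h c) < e"
      using h_lim[OF c] unfolding X limit_metric_sequentially by blast
    then obtain N where "\<forall>n\<ge>N. d (q (c n)) (h c) < e"
      by blast
    then have "d (q (c (i + N))) (h c) < e" by simp
    then show "d (q (c i)) (h c) \<le> 2 * (1/2) ^ i + e"
      using dist_le[OF c, of i N] triangle[of "q (c i)" "q (c (i + N))" "h c"] hM by simp
  qed
  have "\<exists>c. h c = x" if "x \<in> topspace X" for x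
  proof -
    have x: "x \<in> M" using that X by simp
    \<comment> \<open>With these radii consecutive points are at distance less than 1/4 + 1/8 of
      \<open>(1/2) ^ i\<close>, so the chosen sequence is fast.\<close>
    have "\<exists>n. q n \<in> mball x ((1/2) ^ i / 4)" for i :: nat
    proof -
      have "openin X (mball x ((1/2) ^ i / 4))" "x \<in> mball x ((1/2) ^ i / 4)"
        using X x by auto
      then show ?thesis
        using dense_sequenceD[OF q] by blast
    qed
    then obtain c where c: "\<And>i. q (c i) \<in> mball x ((1/2) ^ i / 4)"
      by metis
    then have c': "d x (q (c i)) < (1/2) ^ i / 4" for i
      by simp
    have "d (q (c i)) (q (c (Suc i))) < (1/2) ^ i" for i
    proof -
      have "d (q (c i)) (q (c (Suc i))) \<le> d x (q (c i)) + d x (q (c (Suc i)))"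
        using triangle[of "q (c i)" x "q (c (Suc i))"] x commute[of x "q (c i)"] by simp
      moreover have "d x (q (c (Suc i))) < (1/2) ^ i / 8"
        using c'[of "Suc i"] by simp
      moreover have "(0::real) < (1/2) ^ i"
        by simp
      ultimately show ?thesis
        using c'[of i] by linarith
    qed
    then have fast: "fast c" by (simp add: fast_def)
    have "d x (h c) \<le> 0 + e" if e: "e > 0" for e
    proof -
      obtain i where i: "2 * (1/2 :: real) ^ i < e / 2"
        using small[of "e / 2"] e by auto
      have "d x (h c) \<le> d x (q (c i)) + d (q (c i)) (h c)"
        using triangle x hM by simp
      moreover have "(0::real) < (1/2) ^ i"
        by simp
      ultimately show ?thesis
        using c'[of i] h_dist[OF fast, of i] i by linarith
    qed
    then have "d x (h c) \<le> 0"
      by (rule field_le_epsilon)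
    then have "h c = x"
      using x hM[of c] nonneg[of x "h c"] zero[of x "h c"] by auto
    then show ?thesis by blast
  qed
  moreover have "h \<in> measurable baire_space (borel_space_of X)"
  proof (rule measurable_borel_space_ofI)
    fix U assume U: "openin X U"
    \<comment> \<open>By \<open>h_dist\<close> each of these balls contains the limit, and they
      shrink to it. Membership of the limit in \<open>U\<close> thus becomes a countable union of
      conditions on single entries of \<open>c\<close>.\<close>
    have ex: "h c \<in> U \<longleftrightarrow> (\<exists>i. mcball (q (c i)) (2 * (1/2) ^ i) \<subseteq> U)" if c: "fast c" for c
    proof
      assume "h c \<in> U"
      then obtain r where r: "r > 0" "mball (h c) r \<subseteq> U"
        using U X openin_mtopology by blast
      obtain i where i: "2 * (1/2 :: real) ^ i < r / 2"
        using small[of "r / 2"] r by auto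
      have "mcball (q (c i)) (2 * (1/2) ^ i) \<subseteq> mball (h c) r"
      proof
        fix y assume "y \<in> mcball (q (c i)) (2 * (1/2) ^ i)"
        then show "y \<in> mball (h c) r"
          using h_dist[OF c, of i] i triangle[of "h c" "q (c i)" y] hM commute[of "h c" "q (c i)"]
          by auto
      qed
      then show "\<exists>i. mcball (q (c i)) (2 * (1/2) ^ i) \<subseteq> U"
        using r by blast
    next
      assume "\<exists>i. mcball (q (c i)) (2 * (1/2) ^ i) \<subseteq> U"
      then obtain i where "mcball (q (c i)) (2 * (1/2) ^ i) \<subseteq> U" ..
      then show "h c \<in> U"
        using h_dist[OF c, of i] hM by auto
    qed
    have comp [measurable]: "Measurable.pred baire_space (\<lambda>c. P (c i))" for P :: "nat \<Rightarrow> bool" and i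
      by (rule measurable_compose[OF measurable_component_singleton]) auto
    have [measurable]: "Measurable.pred baire_space fast"
    proof -
      \<comment> \<open>Quantifying over the countably many values \<open>a\<close>,
        \<open>b\<close> leaves only conditions on single entries of \<open>c\<close>.\<close>
      have "fast = (\<lambda>c. \<forall>i a b. c i = a \<longrightarrow> c (Suc i) = b \<longrightarrow> d (q a) (q b) < (1/2) ^ i)"
        by (auto simp: fast_def fun_eq_iff)
      then show ?thesis by simp
    qed
    have "h -` U \<inter> space baire_space = {c \<in> space baire_space.
        (fast c \<and> (\<exists>i. mcball (q (c i)) (2 * (1/2) ^ i) \<subseteq> U)) \<or> (\<not> fast c \<and> q 0 \<in> U)}"
    proof -
      have "h c = q 0" if "\<not> fast c" for c
        using that by (simp add: h_def)
      then have "h c \<in> U \<longleftrightarrow> (fast c \<and> (\<exists>i. mcball (q (c i)) (2 * (1/2) ^ i) \<subseteq> U)) \<or>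
          (\<not> fast c \<and> q 0 \<in> U)" for c
        using ex[of c] by metis
      then show ?thesis
        by blast
    qed
    also have "\<dots> \<in> sets baire_space" by measurable
    finally show "h -` U \<inter> space baire_space \<in> sets baire_space" .
  qed (use hM X in auto)
  ultimately show ?thesis by blast
qed

section \<open>The graph on the product\<close>

text \<open>The lexicographic order of the sequences of bits that record membership in the base sets.\<close>

definition base_less :: "(nat \<Rightarrow> 'a set) \<Rightarrow> 'a \<Rightarrow> 'a \<Rightarrow> bool" where
  "base_less U x y \<longleftrightarrow> (\<exists>n. x \<in> U n \<and> y \<notin> U n \<and> (\<forall>m<n. x \<in> U m \<longleftrightarrow> y \<in> U m))"

text \<open>The base separates the two points, and the first set that does so decides the comparison
  in both directions. Exchanging the ends of an edge therefore flips the bit read off it.\<close>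

lemma base_less_swap:
  assumes "polish_topology X" "countable_base X U"
    and "x \<in> topspace X" "y \<in> topspace X" "x \<noteq> y"
  shows "base_less U y x \<longleftrightarrow> \<not> base_less U x y"
proof -
  have "Hausdorff_space X"
    using assms(1) completely_metrizable_imp_metrizable_space metrizable_imp_Hausdorff_space
    by (auto simp: polish_topology_def)
  then obtain V W where VW: "openin X V" "openin X W" "x \<in> V" "y \<in> W" "disjnt V W"
    using assms unfolding Hausdorff_space_def by metis
  then obtain k where "x \<in> U k" "U k \<subseteq> V"
    using assms(2) unfolding countable_base_def by metis
  with VW have ex: "\<exists>k. (x \<in> U k) \<noteq> (y \<in> U k)"
    by (auto simp: disjnt_iff)
  define n where "n = (LEAST k. (x \<in> U k) \<noteq> (y \<in> U k))"
  have n: "(x \<in> U n) \<noteq> (y \<in> U n)"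
    unfolding n_def by (rule LeastI_ex[OF ex])
  have least: "(x \<in> U m) = (y \<in> U m)" if "m < n" for m
    using not_less_Least that unfolding n_def by blast
  have "base_less U a b \<longleftrightarrow> a \<in> U n" if ab: "{a, b} = {x, y}" for a b
  proof
    assume "base_less U a b"
    then obtain k where k: "a \<in> U k" "b \<notin> U k" "\<And>m. m < k \<Longrightarrow> a \<in> U m \<longleftrightarrow> b \<in> U m"
      unfolding base_less_def by auto
    have "\<not> k < n" "\<not> n < k"
      using k least n ab by (metis doubleton_eq_iff)+
    then show "a \<in> U n"
      using k by (metis linorder_neqE_nat)
  next
    assume "a \<in> U n"
    moreover have "b \<notin> U n" "\<And>m. m < n \<Longrightarrow> a \<in> U m \<longleftrightarrow> b \<in> U m"
      using n least ab \<open>a \<in> U n\<close> by (metis doubleton_eq_iff)+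
    ultimately show "base_less U a b"
      unfolding base_less_def by blast
  qed
  then show ?thesis
    using n by (metis insert_commute)
qed

text \<open>At a coordinate of difference this is its rank, counted from 0, among all coordinates of
  difference.\<close>

definition diff_position :: "(nat \<Rightarrow> 'a) \<Rightarrow> (nat \<Rightarrow> 'a) \<Rightarrow> nat \<Rightarrow> nat" where
  "diff_position u v j = card {i. i < j \<and> u i \<noteq> v i}"

lemma diff_position_0: "diff_position u v 0 = 0"
  by (simp add: diff_position_def)

lemma diff_position_Suc:
  "diff_position u v (Suc j) = (if u j \<noteq> v j then Suc (diff_position u v j) else diff_position u v j)"
proof -
  have "{i. i < Suc j \<and> u i \<noteq> v i} =
      (if u j \<noteq> v j then insert j {i. i < j \<and> u i \<noteq> v i} else {i. i < j \<and> u i \<noteq> v i})"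
    by (auto simp: less_Suc_eq)
  then show ?thesis
    by (simp add: diff_position_def)
qed

lemma diff_position_strict_mono:
  assumes "i < j" "u i \<noteq> v i"
  shows "diff_position u v i < diff_position u v j"
  unfolding diff_position_def using assms by (intro psubset_card_mono) auto

lemma diff_position_inj:
  assumes "u i \<noteq> v i" "u j \<noteq> v j" "diff_position u v i = diff_position u v j"
  shows "i = j"
  using assms diff_position_strict_mono by (metis linorder_neqE_nat nat_neq_iff)

text \<open>The \<open>k\<close>-th element of the increasing enumeration of the differences has
  exactly \<open>k\<close> predecessors. Infinitely many differences thus give room for every
  bit.\<close>

lemma diff_position_surj:
  assumes "infinite {i. u i \<noteq> v i}"
  shows "\<exists>j. u j \<noteq> v j \<and> diff_position u v j = k"
proof -
  let ?D = "{i. u i \<noteq> v i}"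
  have "{i. i < enumerate ?D k \<and> u i \<noteq> v i} = enumerate ?D ` {..<k}"
  proof (intro subset_antisym subsetI)
    fix i assume i: "i \<in> {i. i < enumerate ?D k \<and> u i \<noteq> v i}"
    then obtain n where "i = enumerate ?D n"
      using enumerate_Ex[of ?D i] assms by auto
    with i show "i \<in> enumerate ?D ` {..<k}"
      using enumerate_mono_iff[OF assms] by auto
  next
    fix i assume "i \<in> enumerate ?D ` {..<k}"
    then show "i \<in> {i. i < enumerate ?D k \<and> u i \<noteq> v i}"
      using enumerate_mono[OF _ assms] enumerate_in_set[OF assms] by auto
  qed
  moreover have "inj_on (enumerate ?D) {..<k}"
    using bij_enumerate[OF assms] by (auto simp: bij_betw_def intro: inj_on_subset)
  ultimately have "diff_position u v (enumerate ?D k) = k"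
    unfolding diff_position_def by (simp add: card_image)
  then show ?thesis
    using enumerate_in_set[OF assms] by blast
qed

section \<open>Moves, codes and the product graph\<close>

locale graph_sequence =
  fixes X :: "nat \<Rightarrow> 'a topology" and G :: "nat \<Rightarrow> ('a \<times> 'a) set"
    and U :: "nat \<Rightarrow> nat \<Rightarrow> 'a set" and point :: "nat \<Rightarrow> (nat \<Rightarrow> nat) \<Rightarrow> 'a"
  assumes polish: "\<And>j. polish_topology (X j)"
    and base: "\<And>j. countable_base (X j) (U j)"
    and graph: "\<And>j. borel_graph (X j) (G j)"
    and point_measurable: "\<And>j. point j \<in> measurable baire_space (borel_space_of (X j))"
    and point_surj: "\<And>j x. x \<in> topspace (X j) \<Longrightarrow> \<exists>c. point j c = x"
begin

abbreviation P :: "(nat \<Rightarrow> 'a) set" where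
  "P \<equiv> topspace (product_topology X UNIV)"

abbreviation W :: "((nat \<Rightarrow> 'a) \<times> (nat \<Rightarrow> 'a)) measure" where
  "W \<equiv> borel_space_of (prod_topology (product_topology X UNIV) (product_topology X UNIV))"

lemma P_iff: "x \<in> P \<longleftrightarrow> (\<forall>j. x j \<in> topspace (X j))"
  by (auto simp: PiE_iff)

lemma G_borel: "G j \<in> sets (borel_space_of (X j) \<Otimes>\<^sub>M borel_space_of (X j))"
  using graph[of j] borel_prod_topology_subset[OF base[of j]]
  by (auto simp: borel_graph_def sets_borel_space_of)

lemma G_sym: "(a, b) \<in> G j \<Longrightarrow> (b, a) \<in> G j"
  using graph[of j] by (auto simp: borel_graph_def sym_def)

lemma G_irrefl: "(a, b) \<in> G j \<Longrightarrow> a \<noteq> b"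
  using graph[of j] by (auto simp: borel_graph_def irrefl_def)

lemma G_topspace: "(a, b) \<in> G j \<Longrightarrow> a \<in> topspace (X j) \<and> b \<in> topspace (X j)"
  using sets.sets_into_space[OF G_borel[of j]] by (auto simp: space_pair_measure)

lemma G_rtrancl_topspace: "(a, b) \<in> (G j)\<^sup>* \<Longrightarrow> a \<in> topspace (X j) \<Longrightarrow> b \<in> topspace (X j)"
  by (induction rule: rtrancl_induct) (auto dest: G_topspace)

text \<open>The ranks of parity \<open>e\<close> are \<open>2 * k + e\<close>. At most one
  \<open>j\<close> has a given rank, so the existential merely selects it.\<close>

definition code_bit :: "nat \<Rightarrow> (nat \<Rightarrow> 'a) \<Rightarrow> (nat \<Rightarrow> 'a) \<Rightarrow> nat \<Rightarrow> bool" where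
  "code_bit e u v k \<longleftrightarrow>
     (\<exists>j. u j \<noteq> v j \<and> diff_position u v j = 2 * k + e \<and> base_less (U j) (u j) (v j))"

text \<open>The bit at \<open>(j, l, t, m)\<close> is meant to say that entry \<open>t\<close> of
  the name of vertex \<open>l\<close> in coordinate \<open>j\<close> is \<open>m\<close>.
  \<open>LEAST\<close> decodes every bit sequence to some vertex, sensible or not.\<close>

definition coded_vertex :: "nat \<Rightarrow> (nat \<Rightarrow> 'a) \<Rightarrow> (nat \<Rightarrow> 'a) \<Rightarrow> nat \<Rightarrow> nat \<Rightarrow> 'a" where
  "coded_vertex e u v j l = point j (\<lambda>t. LEAST m. code_bit e u v (to_nat (j, l, t, m)))"

text \<open>Only the length is quantified, over a countable set; the vertices are Borel functions of
  the pair. This replaces the analytic quantifier over paths.\<close>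

definition coded_path :: "nat \<Rightarrow> (nat \<Rightarrow> 'a) \<Rightarrow> (nat \<Rightarrow> 'a) \<Rightarrow> nat \<Rightarrow> bool" where
  "coded_path e u v j \<longleftrightarrow>
     (\<exists>n. coded_vertex e u v j 0 = u j \<and> coded_vertex e u v j n = v j \<and>
        (\<forall>l<n. (coded_vertex e u v j l, coded_vertex e u v j (Suc l)) \<in> G j))"

definition step_graph :: "((nat \<Rightarrow> 'a) \<times> (nat \<Rightarrow> 'a)) set" where
  "step_graph = {(u, v). u \<in> P \<and> v \<in> P \<and> (\<forall>j. u j = v j \<or> (u j, v j) \<in> G j)}"

definition coding_graph :: "nat \<Rightarrow> ((nat \<Rightarrow> 'a) \<times> (nat \<Rightarrow> 'a)) set" where
  "coding_graph e = {(u, v). u \<in> P \<and> v \<in> P \<and> (\<forall>j. u j = v j \<or>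
     (if diff_position u v j mod 2 = e then (u j, v j) \<in> G j else coded_path e u v j))}"

definition move_graph :: "((nat \<Rightarrow> 'a) \<times> (nat \<Rightarrow> 'a)) set" where
  "move_graph = step_graph \<union> coding_graph 0 \<union> coding_graph 1"

text \<open>The code depends on the orientation of the pair, and staying still is a move; hence the
  converse and the removal of \<open>Id\<close>.\<close>

definition product_graph :: "((nat \<Rightarrow> 'a) \<times> (nat \<Rightarrow> 'a)) set" where
  "product_graph = (move_graph \<union> move_graph\<inverse>) - Id"

section \<open>The product graph is Borel\<close>

lemma coordinate_measurable:
  "(\<lambda>w. fst w j) \<in> measurable W (borel_space_of (X j))"
  "(\<lambda>w. snd w j) \<in> measurable W (borel_space_of (X j))"
proof -
  have "continuous_map (product_topology X UNIV) (X j) (\<lambda>x. x j)"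
    by (rule continuous_map_product_projection) simp
  note proj = continuous_map_compose[OF continuous_map_fst this, unfolded o_def]
    continuous_map_compose[OF continuous_map_snd this, unfolded o_def]
  show "(\<lambda>w. fst w j) \<in> measurable W (borel_space_of (X j))"
      "(\<lambda>w. snd w j) \<in> measurable W (borel_space_of (X j))"
    by (rule continuous_map_measurable_borel[OF proj(1)], rule continuous_map_measurable_borel[OF proj(2)])
qed

lemma pair_pred:
  assumes "f \<in> measurable W (borel_space_of (X j))" "g \<in> measurable W (borel_space_of (X j))"
    and "R \<in> sets (borel_space_of (X j) \<Otimes>\<^sub>M borel_space_of (X j))"
  shows "Measurable.pred W (\<lambda>w. (f w, g w) \<in> R)"
  by (rule measurable_compose[OF measurable_Pair[OF assms(1,2)]]) (use assms(3) in simp)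

lemma eq_pred:
  assumes f: "f \<in> measurable W (borel_space_of (X j))" and g: "g \<in> measurable W (borel_space_of (X j))"
  shows "Measurable.pred W (\<lambda>w. f w = g w)"
proof -
  have "Measurable.pred W (\<lambda>w. (f w, g w) \<in> {(x, x) | x. x \<in> topspace (X j)})"
    by (rule pair_pred[OF f g diagonal_in_borel[OF polish base]])
  moreover have "(f w, g w) \<in> {(x, x) | x. x \<in> topspace (X j)} \<longleftrightarrow> f w = g w" if "w \<in> space W" for w
    using measurable_space[OF f that] by auto
  ultimately show ?thesis
    by (subst measurable_cong[where g = "\<lambda>w. (f w, g w) \<in> {(x, x) | x. x \<in> topspace (X j)}"]) auto
qed

lemma coordinate_eq_pred [measurable]: "Measurable.pred W (\<lambda>w. fst w j = snd w j)"
  by (rule eq_pred[where j = j]) (rule coordinate_measurable)+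

lemma coordinate_edge_pred [measurable]: "Measurable.pred W (\<lambda>w. (fst w j, snd w j) \<in> G j)"
  by (rule pair_pred[where j = j]) (rule coordinate_measurable G_borel)+

lemma base_less_pred [measurable]: "Measurable.pred W (\<lambda>w. base_less (U j) (fst w j) (snd w j))"
proof -
  have [measurable]: "U j n \<in> sets (borel_space_of (X j))" for n
    using base by (auto simp: countable_base_def intro: openin_in_borel)
  note coordinate_measurable [measurable]
  show ?thesis
    unfolding base_less_def by measurable
qed

lemma diff_position_pred [measurable]: "Measurable.pred W (\<lambda>w. diff_position (fst w) (snd w) j = k)"
proof (induction j arbitrary: k)
  case 0
  then show ?case by (simp add: diff_position_0)
next
  case (Suc j)
  \<comment> \<open>The guard \<open>k \<noteq> 0\<close> protects the truncated subtraction
    \<open>k - 1\<close>.\<close>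
  have eq: "(\<lambda>w. diff_position (fst w) (snd w) (Suc j) = k) = (\<lambda>w.
      (fst w j = snd w j \<and> diff_position (fst w) (snd w) j = k) \<or>
      (fst w j \<noteq> snd w j \<and> k \<noteq> 0 \<and> diff_position (fst w) (snd w) j = k - 1))"
    by (auto simp: diff_position_Suc)
  show ?case
    unfolding eq using Suc by measurable
qed

lemma code_bit_pred [measurable]: "Measurable.pred W (\<lambda>w. code_bit e (fst w) (snd w) k)"
  unfolding code_bit_def by measurable

text \<open>Each entry of the decoded sequence is a \<open>LEAST\<close> over countably many Borel
  conditions, and \<open>point j\<close> is Borel.\<close>

lemma coded_vertex_measurable:
  "(\<lambda>w. coded_vertex e (fst w) (snd w) j l) \<in> measurable W (borel_space_of (X j))"
  unfolding coded_vertex_def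
proof (rule measurable_compose[OF _ point_measurable])
  show "(\<lambda>w t. LEAST m. code_bit e (fst w) (snd w) (to_nat (j, l, t, m))) \<in> measurable W baire_space"
    by (rule measurable_PiM_single') (rule measurable_Least code_bit_pred | simp)+
qed

lemma coded_path_pred [measurable]: "Measurable.pred W (\<lambda>w. coded_path e (fst w) (snd w) j)"
proof -
  have [measurable]: "Measurable.pred W (\<lambda>w. coded_vertex e (fst w) (snd w) j l = fst w j)"
      "Measurable.pred W (\<lambda>w. coded_vertex e (fst w) (snd w) j l = snd w j)"
      "Measurable.pred W (\<lambda>w. (coded_vertex e (fst w) (snd w) j l,
         coded_vertex e (fst w) (snd w) j (Suc l)) \<in> G j)" for l
    by (rule eq_pred[OF coded_vertex_measurable coordinate_measurable(1)]
        eq_pred[OF coded_vertex_measurable coordinate_measurable(2)]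
        pair_pred[OF coded_vertex_measurable coded_vertex_measurable G_borel])+
  show ?thesis
    unfolding coded_path_def by measurable
qed

lemma coding_graph_borel: "coding_graph e \<in> sets W"
proof -
  have [measurable]: "Measurable.pred W (\<lambda>w. diff_position (fst w) (snd w) j mod 2 = e)" for j
  proof -
    have eq: "(\<lambda>w. diff_position (fst w) (snd w) j mod 2 = e) =
        (\<lambda>w. \<exists>k. diff_position (fst w) (snd w) j = k \<and> k mod 2 = e)"
      by auto
    show ?thesis
      unfolding eq by measurable
  qed
  have "coding_graph e = {w \<in> space W. \<forall>j. fst w j = snd w j \<or>
      (diff_position (fst w) (snd w) j mod 2 = e \<and> (fst w j, snd w j) \<in> G j) \<or>
      (diff_position (fst w) (snd w) j mod 2 \<noteq> e \<and> coded_path e (fst w) (snd w) j)}"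
    unfolding coding_graph_def by (auto split: if_splits)
  also have "\<dots> \<in> sets W" by measurable
  finally show ?thesis .
qed

lemma move_graph_borel: "move_graph \<in> sets W"
proof -
  have "step_graph = {w \<in> space W. \<forall>j. fst w j = snd w j \<or> (fst w j, snd w j) \<in> G j}"
    unfolding step_graph_def by auto
  also have "\<dots> \<in> sets W" by measurable
  finally show ?thesis
    unfolding move_graph_def using coding_graph_borel by auto
qed

text \<open>The converse is a preimage under the swap, and the diagonal is a countable intersection
  of coordinate equalities.\<close>

lemma product_graph_borel: "borel_graph (product_topology X UNIV) product_graph"
proof -
  let ?PX = "product_topology X UNIV"
  have "continuous_map (prod_topology ?PX ?PX) (prod_topology ?PX ?PX) prod.swap"
    unfolding continuous_map_pairwise prod.swap_def o_def fst_conv snd_conv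
    by (intro conjI continuous_map_fst continuous_map_snd)
  then have swap: "prod.swap \<in> measurable W W"
    by (rule continuous_map_measurable_borel)
  have "move_graph \<subseteq> space W"
    by (rule sets.sets_into_space[OF move_graph_borel])
  then have "move_graph\<inverse> = prod.swap -` move_graph \<inter> space W"
    by auto
  then have "move_graph\<inverse> \<in> sets W"
    using measurable_sets[OF swap move_graph_borel] by simp
  moreover have "{w \<in> space W. \<forall>j. fst w j = snd w j} \<in> sets W"
    by measurable
  moreover have "product_graph =
      (move_graph \<union> move_graph\<inverse>) - {w \<in> space W. \<forall>j. fst w j = snd w j}"
    using \<open>move_graph \<subseteq> space W\<close> unfolding product_graph_def by (auto simp: fun_eq_iff)
  ultimately have "product_graph \<in> sets W"
    using move_graph_borel by simp
  then show ?thesis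
    unfolding borel_graph_def sets_borel_space_of
    by (auto simp: product_graph_def sym_def irrefl_def)
qed

section \<open>Paths in the product project to paths in every coordinate\<close>

lemma coded_path_rtrancl:
  assumes "coded_path e u v j"
  shows "(u j, v j) \<in> (G j)\<^sup>*"
proof -
  obtain n where n: "coded_vertex e u v j 0 = u j" "coded_vertex e u v j n = v j"
      "\<And>l. l < n \<Longrightarrow> (coded_vertex e u v j l, coded_vertex e u v j (Suc l)) \<in> G j"
    using assms unfolding coded_path_def by auto
  have "k \<le> n \<Longrightarrow> (u j, coded_vertex e u v j k) \<in> (G j)\<^sup>*" for k
  proof (induction k)
    case (Suc k)
    then show ?case
      using n(3)[of k] by (auto intro: rtrancl.rtrancl_into_rtrancl)
  qed (simp add: n)
  then show ?thesis
    using n(2) by (metis order_refl)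
qed

text \<open>Soundness does not depend on how the code arose: a decoded path counts only if all its
  edges and both its ends have been checked.\<close>

lemma move_graph_coordinate:
  assumes "(u, v) \<in> move_graph"
  shows "(u j, v j) \<in> (G j)\<^sup>*"
proof -
  have "u j = v j \<or> (u j, v j) \<in> G j \<or> (\<exists>e. coded_path e u v j)"
  proof -
    consider "(u, v) \<in> step_graph" | e where "(u, v) \<in> coding_graph e"
      using assms unfolding move_graph_def by blast
    then show ?thesis
    proof cases
      case 1
      then show ?thesis
        unfolding step_graph_def by blast
    next
      case 2
      then have "u j = v j \<or>
          (if diff_position u v j mod 2 = e then (u j, v j) \<in> G j else coded_path e u v j)"
        unfolding coding_graph_def by blast
      then show ?thesis
        by (auto split: if_splits)
    qed
  qed
  then show ?thesis
    using coded_path_rtrancl by auto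
qed

lemma product_graph_coordinate:
  assumes "(u, v) \<in> product_graph\<^sup>*"
  shows "(u j, v j) \<in> (G j)\<^sup>*"
  using assms
proof (induction rule: rtrancl_induct)
  case (step v w)
  have "sym ((G j)\<^sup>*)"
    using G_sym by (intro sym_rtrancl) (auto simp: sym_def)
  then have "(v j, w j) \<in> (G j)\<^sup>*"
    using step(2) move_graph_coordinate by (auto simp: product_graph_def dest: symD)
  with step(3) show ?case by simp
qed simp

section \<open>Paths between related points of the product\<close>

lemma single_coordinate_step_path:
  assumes "x \<in> P" "(x j, b) \<in> (G j)\<^sup>*"
  shows "(x, x(j := b)) \<in> step_graph\<^sup>*"
  using assms(2)
proof (induction rule: rtrancl_induct)
  case (step b c)
  have "(x(j := b), x(j := c)) \<in> step_graph"
    using assms(1) step(2) G_topspace[OF step(2)] by (auto simp: step_graph_def P_iff simp del: topspace_product_topology)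
  with step(3) show ?case by (rule rtrancl_into_rtrancl)
qed simp

text \<open>Coordinates are corrected one after the other, so path lengths in different coordinates
  need not match. The start \<open>x\<close> varies in the induction.\<close>

lemma finite_step_path:
  assumes "finite F" "x \<in> P" "\<And>j. (x j, y j) \<in> (G j)\<^sup>*" "\<And>j. j \<notin> F \<Longrightarrow> x j = y j"
  shows "(x, y) \<in> step_graph\<^sup>*"
  using assms
proof (induction F arbitrary: x rule: finite_induct)
  case empty
  then have "x = y" by auto
  then show ?case by simp
next
  case (insert i F)
  have "(x, x(i := y i)) \<in> step_graph\<^sup>*"
    using insert.prems by (intro single_coordinate_step_path) auto
  moreover have "x(i := y i) \<in> P"
    using insert.prems(1,2) G_rtrancl_topspace[OF insert.prems(2)[of i]]
    by (auto simp: P_iff simp del: topspace_product_topology)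
  then have "(x(i := y i), y) \<in> step_graph\<^sup>*"
    using insert.prems by (intro insert.IH) auto
  ultimately show ?case by (rule rtrancl_trans)
qed

lemma rtrancl_vertex_codes:
  assumes "(a, b) \<in> (G j)\<^sup>*" "a \<in> topspace (X j)"
  shows "\<exists>c n. point j (c 0) = a \<and> point j (c n) = b \<and>
     (\<forall>l<n. (point j (c l), point j (c (Suc l))) \<in> G j)"
proof -
  obtain n where "(a, b) \<in> G j ^^ n"
    using assms(1) rtrancl_imp_relpow by blast
  then obtain f where f: "f 0 = a" "f n = b" "\<And>l. l < n \<Longrightarrow> (f l, f (Suc l)) \<in> G j"
    unfolding relpow_fun_conv by blast
  \<comment> \<open>The start lies in the space by assumption, every later vertex as the end of an
    edge. The implication inside the existential allows a choice of \<open>c\<close> for all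
    \<open>l\<close> at once.\<close>
  have "\<exists>c. l \<le> n \<longrightarrow> point j c = f l" for l
  proof (cases "l \<le> n")
    case True
    have "f l \<in> topspace (X j)"
    proof (cases l)
      case 0
      then show ?thesis using f(1) assms(2) by simp
    next
      case (Suc k)
      then show ?thesis using f(3)[of k] True by (auto dest: G_topspace)
    qed
    then show ?thesis
      using point_surj by blast
  qed simp
  then obtain c where "\<And>l. l \<le> n \<Longrightarrow> point j (c l) = f l"
    by metis
  with f show ?thesis
    by (intro exI[of _ c] exI[of _ n]) auto
qed

text \<open>On the coordinates of the parity that carries the code, the coding edge swaps the coordinate
  of \<^term>\<open>x\<close> with a neighbour. Which of the two ends comes first is decided by the bit that has to be
  stored, so that every code can be realised.\<close>

lemma half_move:
  assumes x: "x \<in> P" and e: "e < 2"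
    and inf: "infinite {j. x0 j \<noteq> y0 j}"
    and nbr: "\<And>j. x0 j \<noteq> y0 j \<Longrightarrow> \<exists>b. (x j, b) \<in> G j"
    and y: "\<And>j. (x j, y j) \<in> (G j)\<^sup>*"
    and eq_iff: "\<And>j. diff_position x0 y0 j mod 2 = e \<Longrightarrow> x j = y j"
      "\<And>j. diff_position x0 y0 j mod 2 \<noteq> e \<Longrightarrow> x j = y j \<longleftrightarrow> x0 j = y0 j"
  shows "(x, y) \<in> move_graph\<^sup>*"
proof -
  \<comment> \<open>\<open>x0\<close> and \<open>y0\<close> are the ends of the whole path and fix
    the ranks; \<open>x\<close> and \<open>y\<close> are the ends of one half, which agree on the
    carrying coordinates \<open>B\<close>.\<close>
  define pos where "pos = diff_position x0 y0"
  define B where "B = {j. x0 j \<noteq> y0 j \<and> pos j mod 2 = e}"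
  obtain q where q: "\<And>j. j \<in> B \<Longrightarrow> (x j, q j) \<in> G j"
    using nbr unfolding B_def by (auto) metis
  have "\<exists>c n. point j (c 0) = x j \<and> point j (c n) = y j \<and>
     (\<forall>l<n. (point j (c l), point j (c (Suc l))) \<in> G j)" for j
    using x y by (intro rtrancl_vertex_codes) (auto simp: P_iff simp del: topspace_product_topology)
  then obtain c where c: "\<And>j. \<exists>n. point j (c j 0) = x j \<and> point j (c j n) = y j \<and>
     (\<forall>l<n. (point j (c j l), point j (c j (Suc l))) \<in> G j)"
    by metis
  \<comment> \<open>The bits to be stored. For fixed \<open>j\<close>, \<open>l\<close>,
    \<open>t\<close> exactly one \<open>m\<close> gets a true bit, which \<open>LEAST\<close>
    recovers.\<close>
  define r where "r k = (case from_nat k of (j, l, t, m) \<Rightarrow> c j l t = m)" for k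
  \<comment> \<open>A coordinate of rank \<open>2 * k + e\<close> stores bit \<open>k\<close>, hence
    \<open>div 2\<close>. If the orientation from \<open>x j\<close> to \<open>q j\<close> shows the
    wrong bit, the opposite one is used.\<close>
  define keep where "keep j \<longleftrightarrow> (base_less (U j) (x j) (q j) \<longleftrightarrow> r (pos j div 2))" for j
  define u where "u j = (if j \<in> B \<and> \<not> keep j then q j else x j)" for j
  define v where "v j = (if j \<in> B then if keep j then q j else x j else y j)" for j
  have yP: "y \<in> P"
    using x G_rtrancl_topspace[OF y] by (simp add: P_iff del: topspace_product_topology)
  have uP: "u \<in> P" and vP: "v \<in> P"
    using x yP q G_topspace unfolding u_def v_def
    by (auto simp: P_iff simp del: topspace_product_topology) blast+
  have less: "base_less (U j) (u j) (v j) \<longleftrightarrow> r (pos j div 2)" if "j \<in> B" for j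
    using that base_less_swap[OF polish base, of "x j" j "q j"] G_topspace[OF q[OF that]]
      G_irrefl[OF q[OF that]]
    by (auto simp: u_def v_def keep_def)
  have yB: "y j = x j" if "j \<in> B" for j
    using that eq_iff(1)[of j] by (simp add: B_def pos_def)
  \<comment> \<open>The new pair has the same differences as the original one, hence the same ranks,
    so the bits are read back where they were placed.\<close>
  have uv: "u j \<noteq> v j \<longleftrightarrow> x0 j \<noteq> y0 j" for j
  proof (cases "j \<in> B")
    case True
    then show ?thesis
      using G_irrefl[OF q[OF True]] by (auto simp: u_def v_def B_def)
  next
    case False
    then show ?thesis
      using eq_iff[of j] by (auto simp: u_def v_def B_def pos_def)
  qed
  then have pos: "diff_position u v = pos"
    by (simp add: diff_position_def pos_def fun_eq_iff)
  have bit: "code_bit e u v k \<longleftrightarrow> r k" for k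
  proof -
    obtain i where i: "x0 i \<noteq> y0 i" "pos i = 2 * k + e"
      using diff_position_surj[OF inf] unfolding pos_def by blast
    then have iB: "i \<in> B" and half: "pos i div 2 = k"
      using e by (auto simp: B_def)
    have "j = i" if "x0 j \<noteq> y0 j" "pos j = 2 * k + e" for j
      using diff_position_inj[OF that(1) i(1)] that i by (simp add: pos_def)
    then show ?thesis
      unfolding code_bit_def pos using uv i less[OF iB] half by metis
  qed
  have vertex: "coded_vertex e u v j l = point j (c j l)" for j l
  proof -
    have "(LEAST m. a = m) = a" for a :: nat
      by (rule Least_equality) auto
    then show ?thesis
      by (simp add: coded_vertex_def bit r_def)
  qed
  have "(u, v) \<in> coding_graph e"
    unfolding coding_graph_def
  proof (clarify, intro conjI uP vP allI)
    fix j
    show "u j = v j \<or> (if diff_position u v j mod 2 = e then (u j, v j) \<in> G j else coded_path e u v j)"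
    proof (cases "j \<in> B")
      case True
      then show ?thesis
        using q[OF True] G_sym[OF q[OF True]] by (auto simp: pos B_def u_def v_def)
    next
      case False
      then have "u j = x j" "v j = y j"
        by (auto simp: u_def v_def)
      then have "coded_path e u v j"
        using c[of j] by (simp add: coded_path_def vertex)
      then show ?thesis
        using False uv[of j] by (auto simp: pos B_def)
    qed
  qed
  then have "(u, v) \<in> move_graph"
    using e by (auto simp: move_graph_def less_2_cases_iff)
  \<comment> \<open>The path is \<open>x\<close>, \<open>u\<close>, \<open>v\<close>,
    \<open>y\<close>: the two outer steps only move coordinates in \<open>B\<close> between
    \<open>x j\<close> and \<open>q j\<close>, and the middle move does the rest.\<close>
  moreover have "(x, u) \<in> step_graph"
    using x uP q by (auto simp: step_graph_def u_def simp del: topspace_product_topology)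
  moreover have "(v, y) \<in> step_graph"
    using yP vP q yB G_sym by (auto simp: step_graph_def v_def simp del: topspace_product_topology)
  ultimately show ?thesis
    unfolding move_graph_def by (meson UnI1 r_into_rtrancl rtrancl.rtrancl_into_rtrancl)
qed

lemma move_path:
  assumes x: "x \<in> P" and y: "\<And>j. (x j, y j) \<in> (G j)\<^sup>*"
  shows "(x, y) \<in> move_graph\<^sup>*"
proof (cases "finite {j. x j \<noteq> y j}")
  case True
  then have "(x, y) \<in> step_graph\<^sup>*"
    using x y by (rule finite_step_path) simp
  then show ?thesis
    using rtrancl_mono[of step_graph move_graph] by (auto simp: move_graph_def)
next
  case False
  \<comment> \<open>The midpoint agrees with \<open>x\<close> at even ranks and with
    \<open>y\<close> at odd ones. The even ranks carry the code on the way to \<open>w\<close>, the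
    odd ranks on the way from \<open>w\<close> to \<open>y\<close>.\<close>
  define w where "w j = (if diff_position x y j mod 2 = 0 then x j else y j)" for j
  have symG: "(b, a) \<in> (G j)\<^sup>*" if "(a, b) \<in> (G j)\<^sup>*" for a b j
    using that G_sym by (meson sym_rtrancl symD symI)
  \<comment> \<open>A path between distinct points has a first edge. Both ends are treated because
    \<open>w j\<close> may be either of them.\<close>
  have nbr: "\<exists>b. (x j, b) \<in> G j" "\<exists>b. (y j, b) \<in> G j" if "x j \<noteq> y j" for j
    using that y[of j] symG[OF y[of j]] by (metis converse_rtranclE)+
  have "(x, w) \<in> move_graph\<^sup>*"
    using x y by (intro half_move[OF _ _ False, where e = 0]) (auto simp: w_def nbr(1))
  moreover have "w \<in> P"
    using x G_rtrancl_topspace[OF y] by (simp add: P_iff w_def del: topspace_product_topology)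
  then have "(w, y) \<in> move_graph\<^sup>*"
    using y by (intro half_move[OF _ _ False, where e = 1]) (auto simp: w_def nbr)
  ultimately show ?thesis
    by simp
qed

lemma product_graph_connectedness:
  assumes "x \<in> P" "y \<in> P"
  shows "(x, y) \<in> product_graph\<^sup>* \<longleftrightarrow> (\<forall>j. (x j, y j) \<in> (G j)\<^sup>*)"
proof
  assume "\<forall>j. (x j, y j) \<in> (G j)\<^sup>*"
  then have "(x, y) \<in> move_graph\<^sup>*"
    using move_path assms(1) by blast
  moreover have "move_graph \<subseteq> product_graph\<^sup>*"
    by (auto simp: product_graph_def)
  ultimately show "(x, y) \<in> product_graph\<^sup>*"
    using rtrancl_subset_rtrancl by blast
qed (simp add: product_graph_coordinate)

end

section \<open>The product relation as a connectedness relation\<close>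

lemma equiv_product_relation:
  assumes "\<And>i. equiv (topspace (X i)) (E i)"
  shows "equiv (topspace (product_topology X UNIV)) (product_relation X E)"
proof (rule equivI)
  show "refl_on (topspace (product_topology X UNIV)) (product_relation X E)"
    using assms by (auto simp: refl_on_def product_relation_def equiv_def PiE_iff)
  show "sym (product_relation X E)"
    using assms by (auto simp: sym_def product_relation_def equiv_def)
  show "trans (product_relation X E)"
    using assms unfolding trans_def product_relation_def equiv_def by blast
qed (auto simp: product_relation_def)

theorem theorem5p4:
  fixes X :: "nat \<Rightarrow> 'a topology" and E :: "nat \<Rightarrow> ('a \<times> 'a) set"
  assumes "\<And>i. polish_topology (X i)"
    and "\<And>i. equiv (topspace (X i)) (E i)"
    and "\<And>i. borel_graphable (X i) (E i)"
  shows "borel_graphable (product_topology X UNIV) (product_relation X E)"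
proof -
  have "\<exists>H. borel_graph (product_topology X UNIV) H \<and>
      connectedness_relation (product_topology X UNIV) H = product_relation X E"
  proof (cases "topspace (product_topology X UNIV) = {}")
    case True
    \<comment> \<open>An empty factor has no parametrization by Baire space, but then the product is
      empty too.\<close>
    have "borel_graph (product_topology X UNIV) {}"
      by (simp add: borel_graph_def borel_sets_of_def sigma_sets.Empty sym_def irrefl_def)
    moreover have "connectedness_relation (product_topology X UNIV) {} = product_relation X E"
      using True unfolding connectedness_relation_def product_relation_def by auto
    ultimately show ?thesis by blast
  next
    case False
    then have "topspace (X i) \<noteq> {}" for i
      by (auto simp: PiE_eq_empty_iff)
    then have "\<exists>h \<in> measurable baire_space (borel_space_of (X i)). \<forall>x \<in> topspace (X i). \<exists>c. h c = x" for i
      using polish_topology_borel_surjection assms(1) by blast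
    then obtain h where h: "\<And>i. h i \<in> measurable baire_space (borel_space_of (X i))"
        "\<And>i x. x \<in> topspace (X i) \<Longrightarrow> \<exists>c. h i c = x"
      by metis
    obtain U where U: "\<And>i. countable_base (X i) (U i)"
      using polish_topology_countable_base[OF assms(1)] by metis
    obtain G where G: "\<And>i. borel_graph (X i) (G i)"
        "\<And>i. connectedness_relation (X i) (G i) = E i"
      using assms(3) unfolding borel_graphable_def by metis
    interpret graph_sequence X G U h
      by unfold_locales (use assms(1) U G(1) h in auto)
    have "(x i, y i) \<in> E i \<longleftrightarrow> (x i, y i) \<in> (G i)\<^sup>*" if "x \<in> P" "y \<in> P" for x y i
      using that unfolding P_iff G(2)[symmetric] connectedness_relation_def by auto
    then have "connectedness_relation (product_topology X UNIV) product_graph = product_relation X E"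
      unfolding connectedness_relation_def product_relation_def
      using product_graph_connectedness by blast
    then show ?thesis
      using product_graph_borel by blast
  qed
  then show ?thesis
    unfolding borel_graphable_def
    using polish_topology_product_topology[of X] equiv_product_relation[of X E] assms(1,2) by blast
qed

end
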